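(* Let $\alpha>0$ and $\beta\ge 0$. Suppose that the equality $|E_{\alpha,\beta}(z)|=E_{\alpha,\beta}(\Re z)$ holds for all $z$ in the angular sector $|\arg z|<\varepsilon$ for some $\varepsilon>0$. Then $\alpha=\beta=1$.
   Context: For $\alpha>0$ and $\beta\in\mathbb{R}$, the two-parameter Mittag-Leffler function is the entire function $E_{\alpha,\beta}(z)=\sum_{k=0}^{\infty}\frac{z^k}{\Gamma(\alpha k+\beta)}$, $z\in\mathbb{C}$, with the convention $1/\Gamma(s)=0$ at the poles $s=0,-1,-2,\dots$ of $\Gamma$. $\Re z$ denotes the real part of $z$. *)

theory Defs
  imports "HOL-Complex_Analysis.Complex_Analysis"
begin

text \<open>
  The coefficients use the library's entire reciprocal Gamma function \<^const>\<open>rGamma\<close>,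
  which vanishes at the poles of \<^const>\<open>Gamma\<close>; this matters at \<open>\<alpha> * k + \<beta> = 0\<close>.
  The series converges for all \<open>z\<close> when \<open>\<alpha> > 0\<close>.
\<close>

definition mittag_leffler :: "real \<Rightarrow> real \<Rightarrow> complex \<Rightarrow> complex" where
  "mittag_leffler \<alpha> \<beta> z =
     (\<Sum>k. z ^ k * rGamma (complex_of_real (\<alpha> * real k + \<beta>)))"

end

theory Submission
  imports Defs "HOL-Real_Asymp.Real_Asymp"
begin

text \<open>
  Write \<open>f\<close> for the Mittag-Leffler function. Its coefficients are real, so the hypothesis says
  \<open>f (x + \<i> y) * f (x - \<i> y) = (f x)\<^sup>2\<close> for \<open>x > 0\<close> and small real \<open>y\<close>. Analytic continuation in
  \<open>y\<close> and then in \<open>x\<close> gives \<open>f u * f v = (f ((u + v) / 2))\<^sup>2\<close> for all complex \<open>u\<close> and \<open>v\<close>, hence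
  \<open>f u * f v = f (u + v) * f 0\<close> and \<open>f' = a f\<close>. On coefficients this reads
  \<open>(k + 1) \<Gamma>(\<alpha> k + \<beta>) = a \<Gamma>(\<alpha> k + \<alpha> + \<beta>)\<close>. Log-convexity of \<open>\<Gamma>\<close> gives
  \<open>\<Gamma>(x + \<alpha>) / \<Gamma>(x) \<approx> x\<^sup>\<alpha>\<close>, which forces \<open>\<alpha> = 1\<close>, and then the recurrence yields
  \<open>k + 1 = a (k + \<beta>)\<close> for all \<open>k\<close>.
\<close>

text \<open>Slopes of the convex function \<open>ln \<circ> Gamma\<close> increase, so the slope
  over [x, x + \<alpha>] lies between those over the unit intervals [x - 1, x] and
  [x + \<alpha>, x + \<alpha> + 1]. By the functional equation these two are ln (x - 1) and ln (x +
  \<alpha>). The condition x > 1 keeps x - 1 in the domain of convexity.\<close>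

lemma Gamma_real_add_bounds:
  fixes x \<alpha> :: real
  assumes "x > 1" "\<alpha> > 0"
  shows "(x - 1) powr \<alpha> * Gamma x \<le> Gamma (x + \<alpha>)"
    and "Gamma (x + \<alpha>) \<le> (x + \<alpha>) powr \<alpha> * Gamma x"
proof -
  define L where "L = ln \<circ> (Gamma :: real \<Rightarrow> real)"
  have conv: "convex_on {0<..} L"
    unfolding L_def by (rule log_convex_Gamma_real)
  have step: "L (t + 1) - L t = ln t" if "t > 0" for t
  proof -
    have "t \<notin> \<int>\<^sub>\<le>\<^sub>0"
      using that by (auto elim!: nonpos_Ints_cases')
    moreover have "Gamma t \<noteq> 0"
      using that Gamma_real_pos[of t] by linarith
    ultimately show ?thesis
      using that by (simp add: L_def Gamma_plus1 ln_mult)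
  qed
  have "(L (x - 1) - L x) / ((x - 1) - x) \<le> (L (x - 1) - L (x + \<alpha>)) / ((x - 1) - (x + \<alpha>))"
       "(L (x - 1) - L (x + \<alpha>)) / ((x - 1) - (x + \<alpha>)) \<le> (L x - L (x + \<alpha>)) / (x - (x + \<alpha>))"
    using assms by (intro convex_on_slope_le[OF conv]; simp)+
  then have "ln (x - 1) \<le> (L (x + \<alpha>) - L x) / \<alpha>"
    using step[of "x - 1"] assms by (simp add: field_simps)
  then have lower: "\<alpha> * ln (x - 1) + L x \<le> L (x + \<alpha>)"
    using assms by (simp add: field_simps)
  have "(L x - L (x + \<alpha>)) / (x - (x + \<alpha>)) \<le> (L x - L (x + \<alpha> + 1)) / (x - (x + \<alpha> + 1))"
       "(L x - L (x + \<alpha> + 1)) / (x - (x + \<alpha> + 1))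
          \<le> (L (x + \<alpha>) - L (x + \<alpha> + 1)) / ((x + \<alpha>) - (x + \<alpha> + 1))"
    using assms by (intro convex_on_slope_le[OF conv]; simp)+
  then have "(L (x + \<alpha>) - L x) / \<alpha> \<le> ln (x + \<alpha>)"
    using step[of "x + \<alpha>"] assms by (simp add: field_simps)
  then have upper: "L (x + \<alpha>) \<le> \<alpha> * ln (x + \<alpha>) + L x"
    using assms by (simp add: field_simps)
  have expL: "exp (L t) = Gamma t" if "t > 0" for t
    using that by (simp add: L_def)
  show "(x - 1) powr \<alpha> * Gamma x \<le> Gamma (x + \<alpha>)"
    using exp_le_cancel_iff[THEN iffD2, OF lower] assms by (simp add: exp_add expL powr_def)
  show "Gamma (x + \<alpha>) \<le> (x + \<alpha>) powr \<alpha> * Gamma x"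
    using exp_le_cancel_iff[THEN iffD2, OF upper] assms by (simp add: exp_add expL powr_def)
qed

text \<open>The coefficients are embedded values of the real \<open>rGamma\<close>, so their
  invariance under conjugation is visible to the simplifier.\<close>

definition mittag_leffler_fps :: "real \<Rightarrow> real \<Rightarrow> complex fps" where
  "mittag_leffler_fps \<alpha> \<beta> = Abs_fps (\<lambda>k. complex_of_real (rGamma (\<alpha> * real k + \<beta>)))"

lemma mittag_leffler_fps_nth [simp]:
  "fps_nth (mittag_leffler_fps \<alpha> \<beta>) k = complex_of_real (rGamma (\<alpha> * real k + \<beta>))"
  by (simp add: mittag_leffler_fps_def)

lemma mittag_leffler_eq_eval_fps:
  "mittag_leffler \<alpha> \<beta> = eval_fps (mittag_leffler_fps \<alpha> \<beta>)"
  unfolding mittag_leffler_def eval_fps_def mittag_leffler_fps_nth rGamma_complex_of_real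
  by (simp add: mult.commute)

lemma fps_conv_radius_mittag_leffler:
  assumes "\<alpha> > 0"
  shows "fps_conv_radius (mittag_leffler_fps \<alpha> \<beta>) = \<infinity>"
  unfolding fps_conv_radius_def
proof (rule conv_radius_inftyI'')
  fix z :: complex
  define c where "c = fps_nth (mittag_leffler_fps \<alpha> \<beta>)"
  define r where "r = cmod z"
  \<comment> \<open>The second condition makes Gamma grow by a factor above 2r from one index to the
    next, so consecutive terms of the series at least halve.\<close>
  have "\<forall>\<^sub>F k in sequentially. \<alpha> * real k + \<beta> > 1 \<and> (\<alpha> * real k + \<beta> - 1) powr \<alpha> > 2 * r"
    using assms
    by (intro eventually_conj; real_asymp)
  then obtain N where N: "\<And>k. k \<ge> N \<Longrightarrow> \<alpha> * real k + \<beta> > 1"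
      "\<And>k. k \<ge> N \<Longrightarrow> (\<alpha> * real k + \<beta> - 1) powr \<alpha> > 2 * r"
    unfolding eventually_sequentially by blast
  show "summable (\<lambda>k. fps_nth (mittag_leffler_fps \<alpha> \<beta>) k * z ^ k)"
    unfolding c_def [symmetric]
  proof (rule summable_ratio_test)
    show "(1 / 2 :: real) < 1" by simp
    fix k assume "k \<ge> N"
    define x where "x = \<alpha> * real k + \<beta>"
    have x: "x > 1" "(x - 1) powr \<alpha> > 2 * r"
      using N \<open>k \<ge> N\<close> by (auto simp: x_def)
    have G: "Gamma x > 0" "Gamma (x + \<alpha>) > 0"
      using x assms by auto
    have "2 * r * Gamma x \<le> (x - 1) powr \<alpha> * Gamma x"
      using x G by (intro mult_right_mono) auto
    also have "\<dots> \<le> Gamma (x + \<alpha>)"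
      by (rule Gamma_real_add_bounds) fact+
    finally have "r * rGamma (x + \<alpha>) \<le> 1 / 2 * rGamma x"
      using G by (simp add: rGamma_inverse_Gamma field_simps)
    then have "r ^ k * (r * rGamma (x + \<alpha>)) \<le> r ^ k * (1 / 2 * rGamma x)"
      by (intro mult_left_mono) (auto simp: r_def)
    moreover have "\<alpha> * real (Suc k) + \<beta> = x + \<alpha>"
      by (simp add: x_def algebra_simps)
    moreover have "rGamma x > 0" "rGamma (x + \<alpha>) > 0"
      using G by (simp_all add: rGamma_inverse_Gamma)
    ultimately show "norm (c (Suc k) * z ^ Suc k) \<le> 1 / 2 * norm (c k * z ^ k)"
      unfolding c_def mittag_leffler_fps_nth x_def [symmetric]
      by (simp add: norm_mult norm_power r_def mult_ac)
  qed
qed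

lemma entire_mult_eq_midpoint_square:
  fixes f :: "complex \<Rightarrow> complex"
  assumes hol: "f holomorphic_on UNIV"
    and cnj: "\<And>z. f (cnj z) = cnj (f z)"
    and \<epsilon>: "\<epsilon> > 0"
    and mod: "\<And>z. z \<noteq> 0 \<Longrightarrow> \<bar>Arg z\<bar> < \<epsilon> \<Longrightarrow>
                complex_of_real (cmod (f z)) = f (complex_of_real (Re z))"
  shows "f u * f v = (f ((u + v) / 2))\<^sup>2"
proof -
  have comp: "(\<lambda>z. f (g z)) holomorphic_on UNIV" if "g holomorphic_on UNIV" for g
    using holomorphic_on_compose_gen[OF that hol] by (simp add: o_def)
  have shift: "(\<lambda>z. f (z + c)) holomorphic_on UNIV" "(\<lambda>z. f (z - c)) holomorphic_on UNIV"
    "(\<lambda>z. f (c + z)) holomorphic_on UNIV" "(\<lambda>z. f (c - z)) holomorphic_on UNIV" for c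
    by (rule comp; intro holomorphic_intros)+
  have real: "f (of_real x + w) * f (of_real x - w) - (f (of_real x))\<^sup>2 = 0" if "x > 0" for x w
  proof -
    \<comment> \<open>\<open>\<delta>\<close> runs along the vertical line through x, and
      \<open>U\<close> collects the imaginary shifts that stay in the sector. Continuity of
      \<open>Arg\<close> at x > 0 makes 0 a limit point of \<open>U\<close>.\<close>
    define \<delta> where "\<delta> = (\<lambda>y::real. complex_of_real x + \<i> * of_real y)"
    define U where "U = (\<lambda>y. \<i> * complex_of_real y) ` {y. \<bar>Arg (\<delta> y)\<bar> < \<epsilon>}"
    have "((\<lambda>y. Arg (\<delta> y)) \<longlongrightarrow> Arg (of_real x)) (at 0)"
      unfolding \<delta>_def using that by (intro tendsto_Arg) (auto intro!: tendsto_eq_intros)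
    then have "((\<lambda>y. \<bar>Arg (\<delta> y)\<bar>) \<longlongrightarrow> 0) (at 0)"
      using that by (simp add: tendsto_rabs_zero_iff)
    then have "\<forall>\<^sub>F y in at 0. \<bar>Arg (\<delta> y)\<bar> < \<epsilon>"
      using \<epsilon> by (rule order_tendstoD)
    then obtain d where d: "d > 0" "\<And>y. y \<noteq> 0 \<Longrightarrow> \<bar>y\<bar> < d \<Longrightarrow> \<bar>Arg (\<delta> y)\<bar> < \<epsilon>"
      by (auto simp: eventually_at)
    have lim: "0 islimpt U"
      unfolding islimpt_approachable
    proof (intro allI impI)
      fix e :: real assume "e > 0"
      define y where "y = min d e / 2"
      have "y \<noteq> 0" "\<bar>y\<bar> < d" "\<bar>y\<bar> < e"
        using \<open>e > 0\<close> \<open>d > 0\<close> by (auto simp: y_def)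
      then show "\<exists>w\<in>U. w \<noteq> 0 \<and> dist w 0 < e"
        using d(2) by (intro bexI[of _ "\<i> * of_real y"]) (auto simp: U_def norm_mult)
    qed
    have zero: "f (of_real x + w) * f (of_real x - w) - (f (of_real x))\<^sup>2 = 0"
      if w: "w \<in> U" for w
    proof -
      obtain y where y: "w = \<i> * of_real y" "\<bar>Arg (\<delta> y)\<bar> < \<epsilon>"
        using w unfolding U_def by blast
      have nz: "\<delta> y \<noteq> 0" "Re (\<delta> y) = x"
        using \<open>x > 0\<close> by (auto simp: \<delta>_def complex_eq_iff)
      have eq: "of_real x + w = \<delta> y" "of_real x - w = cnj (\<delta> y)"
        by (simp_all add: y \<delta>_def)
      \<comment> \<open>Conjugate arguments give conjugate values, so the product is a squared
        modulus, to which the hypothesis on the sector applies.\<close>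
      have "f (\<delta> y) * f (cnj (\<delta> y)) = (complex_of_real (cmod (f (\<delta> y))))\<^sup>2"
        by (metis cnj complex_norm_square of_real_power)
      then show ?thesis
        unfolding eq using mod[OF nz(1) y(2)] nz(2) by simp
    qed
    have hol_x: "(\<lambda>w. f (of_real x + w) * f (of_real x - w) - (f (of_real x))\<^sup>2)
        holomorphic_on UNIV"
      by (intro holomorphic_on_diff holomorphic_on_mult holomorphic_on_const shift)
    show ?thesis
      by (rule analytic_continuation[OF hol_x open_UNIV connected_UNIV subset_UNIV UNIV_I lim zero UNIV_I])
  qed
  \<comment> \<open>Second continuation: now w is fixed and x varies, starting from the positive
    reals, which accumulate at 1.\<close>
  have "f (x + w) * f (x - w) - (f x)\<^sup>2 = 0" for x w
  proof (rule analytic_continuation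
      [where f = "\<lambda>x. f (x + w) * f (x - w) - (f x)\<^sup>2"
         and S = UNIV and U = "of_real ` {0<..}" and \<xi> = 1])
    show "1 islimpt (complex_of_real ` {0<..})"
      unfolding islimpt_approachable
    proof (intro allI impI)
      fix e :: real assume "e > 0"
      then have "complex_of_real (1 + e / 2) \<noteq> 1" "dist (complex_of_real (1 + e / 2)) 1 < e"
        by (simp_all add: dist_norm norm_divide)
      with \<open>e > 0\<close> show "\<exists>z\<in>complex_of_real ` {0<..}. z \<noteq> 1 \<and> dist z 1 < e"
        by (intro bexI[of _ "of_real (1 + e / 2)"] imageI) auto
    qed
    show "(\<lambda>x. f (x + w) * f (x - w) - (f x)\<^sup>2) holomorphic_on UNIV"
      by (intro holomorphic_on_diff holomorphic_on_mult holomorphic_on_power hol shift)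
  qed (use real in auto)
  from this[of "(u + v) / 2" "(u - v) / 2"]
  have "f ((u + v) / 2 + (u - v) / 2) * f ((u + v) / 2 - (u - v) / 2) = (f ((u + v) / 2))\<^sup>2"
    by simp
  moreover have "(u + v) / 2 + (u - v) / 2 = u" "(u + v) / 2 - (u - v) / 2 = v"
    by (simp_all add: field_simps)
  ultimately show ?thesis
    by (simp only:)
qed

text \<open>The pairs (u, v) and (u + v, 0) have the same midpoint, which gives f (u + v) f 0 = f u
  f v. Differentiating in v at 0 and dividing by f 0 yields f' = a f with a = f' 0 / f 0. Stated for
  power series, this is a recurrence for the coefficients.\<close>

lemma fps_deriv_eq_const_mult:
  fixes F :: "complex fps"
  assumes rad: "fps_conv_radius F = \<infinity>" and nz: "F \<noteq> 0"
    and mid: "\<And>u v. eval_fps F u * eval_fps F v = (eval_fps F ((u + v) / 2))\<^sup>2"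
  shows "fps_nth F 0 \<noteq> 0" and "\<exists>a. fps_deriv F = fps_const a * F"
proof -
  define f where "f = eval_fps F"
  have exp: "f has_fps_expansion F"
    unfolding f_def using rad by (intro eval_fps_has_fps_expansion) auto
  have f0: "f 0 = fps_nth F 0"
    by (simp add: f_def eval_fps_at_0)
  show *: "fps_nth F 0 \<noteq> 0"
  proof
    assume "fps_nth F 0 = 0"
    \<comment> \<open>The midpoint of 2z and 0 is z, so (f z)^2 = f (2z) f 0 = 0.\<close>
    then have "f = (\<lambda>_. 0)"
      using mid[of "2 * z" 0 for z] f0 by (auto simp: f_def fun_eq_iff)
    then show False
      using exp nz fps_expansion_unique_complex has_fps_expansion_0 by metis
  qed
  have hol: "f holomorphic_on UNIV"
    unfolding f_def by (intro holomorphic_intros) (use rad in auto)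
  have add: "f (u + v) * f 0 = f u * f v" for u v
    using mid[of u v] mid[of "u + v" 0] by (simp add: f_def)
  have "deriv f u = deriv f 0 / f 0 * f u" for u
  proof -
    have df: "(f has_field_derivative deriv f w) (at w)" for w
      using hol by (intro holomorphic_derivI[of f UNIV]) auto
    have "((\<lambda>v. f (u + v) * f 0) has_field_derivative deriv f u * f 0) (at 0)"
      using df[of u] DERIV_shift[of f _ 0 u] by (intro DERIV_cmult_right) (simp add: add.commute)
    moreover have "((\<lambda>v. f u * f v) has_field_derivative f u * deriv f 0) (at 0)"
      by (intro DERIV_cmult df)
    ultimately have "deriv f u * f 0 = f u * deriv f 0"
      unfolding add by (rule DERIV_unique)
    then show ?thesis using * f0 by (simp add: field_simps)
  qed
  then have "deriv f = (\<lambda>u. deriv f 0 / f 0 * f u)"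
    by (rule ext)
  moreover have "(\<lambda>u. deriv f 0 / f 0 * f u) has_fps_expansion fps_const (deriv f 0 / f 0) * F"
    by (intro has_fps_expansion_mult has_fps_expansion_const exp)
  moreover have "deriv f has_fps_expansion fps_deriv F"
    by (intro has_fps_expansion_deriv exp)
  ultimately show "\<exists>a. fps_deriv F = fps_const a * F"
    using fps_expansion_unique_complex by metis
qed

text \<open>The Gamma bounds squeeze (k + 1) / a between two quantities of order k^\<alpha>, so
  linear growth forces \<alpha> = 1. The functional equation of Gamma then turns the recurrence into
  an identity linear in k.\<close>

lemma Gamma_recurrence_imp_one:
  fixes \<alpha> \<beta> a :: real
  assumes "\<alpha> > 0" "\<beta> > 0"
    and rec: "\<And>k. real (Suc k) * Gamma (\<alpha> * real k + \<beta>) = a * Gamma (\<alpha> * real k + \<beta> + \<alpha>)"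
  shows "\<alpha> = 1 \<and> \<beta> = 1"
proof -
  have G: "Gamma (\<alpha> * real k + \<beta>) > 0" "Gamma (\<alpha> * real k + \<beta> + \<alpha>) > 0" for k
    using assms(1,2) by (auto intro!: Gamma_real_pos add_nonneg_pos[OF mult_nonneg_nonneg] add_nonneg_pos[OF add_nonneg_nonneg])
  have a: "a > 0"
    using rec[of 0] G[of 0] by (simp add: zero_less_mult_iff)
  have large: "\<forall>\<^sub>F k in sequentially. \<alpha> * real k + \<beta> > 1"
    using assms by real_asymp
  have lower: "\<forall>\<^sub>F k in sequentially. a * (\<alpha> * real k + \<beta> - 1) powr \<alpha> \<le> real (Suc k)"
    using large
  proof eventually_elim
    case (elim k)
    have "a * (\<alpha> * real k + \<beta> - 1) powr \<alpha> * Gamma (\<alpha> * real k + \<beta>)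
            \<le> a * Gamma (\<alpha> * real k + \<beta> + \<alpha>)"
      using Gamma_real_add_bounds(1)[OF elim \<open>\<alpha> > 0\<close>] a by (simp add: mult.assoc)
    also have "\<dots> = real (Suc k) * Gamma (\<alpha> * real k + \<beta>)"
      by (rule rec[symmetric])
    finally show ?case
      using G(1)[of k] by (rule mult_right_le_imp_le)
  qed
  have upper: "\<forall>\<^sub>F k in sequentially. real (Suc k) \<le> a * (\<alpha> * real k + \<beta> + \<alpha>) powr \<alpha>"
    using large
  proof eventually_elim
    case (elim k)
    have "real (Suc k) * Gamma (\<alpha> * real k + \<beta>) = a * Gamma (\<alpha> * real k + \<beta> + \<alpha>)"
      by (rule rec)
    also have "\<dots> \<le> a * (\<alpha> * real k + \<beta> + \<alpha>) powr \<alpha> * Gamma (\<alpha> * real k + \<beta>)"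
      using Gamma_real_add_bounds(2)[OF elim \<open>\<alpha> > 0\<close>] a by (simp add: mult.assoc)
    finally show ?case
      using G(1)[of k] by (rule mult_right_le_imp_le)
  qed
  have "\<alpha> \<le> 1"
  proof (rule ccontr)
    assume "\<not> \<alpha> \<le> 1"
    then have "\<forall>\<^sub>F k in sequentially. a * (\<alpha> * real k + \<beta> - 1) powr \<alpha> > real (Suc k)"
      using a by real_asymp
    with lower have "\<forall>\<^sub>F k in sequentially. False"
      by eventually_elim simp
    then show False by simp
  qed
  moreover have "\<alpha> \<ge> 1"
  proof (rule ccontr)
    assume "\<not> \<alpha> \<ge> 1"
    then have "\<forall>\<^sub>F k in sequentially. a * (\<alpha> * real k + \<beta> + \<alpha>) powr \<alpha> < real (Suc k)"
      using a \<open>\<alpha> > 0\<close> by real_asymp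
    with upper have "\<forall>\<^sub>F k in sequentially. False"
      by eventually_elim simp
    then show False by simp
  qed
  ultimately have \<alpha>: "\<alpha> = 1" by simp
  have "real (Suc k) = a * (real k + \<beta>)" for k
  proof -
    have "real k + \<beta> \<notin> \<int>\<^sub>\<le>\<^sub>0"
      using \<open>\<beta> > 0\<close> by (auto elim!: nonpos_Ints_cases')
    then show ?thesis
      using rec[of k] G(1)[of k] \<alpha> by (simp add: Gamma_plus1 mult.assoc[symmetric] del: of_nat_Suc)
  qed
  \<comment> \<open>Subtracting the two equations gives a = 1, and then \<beta> = 1.\<close>
  from this[of 0] this[of 1] have "1 = a * \<beta>" "2 = a + a * \<beta>"
    by (simp_all add: algebra_simps)
  then show ?thesis using \<alpha> by simp
qed

text \<open>Since \<open>Arg 0\<close> is 0 by convention, the origin is cut out of the sector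
  explicitly. The equality is between complex numbers, so it includes that the right-hand value is a
  nonnegative real.\<close>

theorem corollary13:
  fixes \<alpha> \<beta> :: real
  assumes "\<alpha> > 0" and "\<beta> \<ge> 0"
    and "\<exists>\<epsilon>>0. \<forall>z. z \<noteq> 0 \<and> \<bar>Arg z\<bar> < \<epsilon> \<longrightarrow>
           complex_of_real (cmod (mittag_leffler \<alpha> \<beta> z)) =
             mittag_leffler \<alpha> \<beta> (complex_of_real (Re z))"
  shows "\<alpha> = 1 \<and> \<beta> = 1"
proof -
  define F where "F = mittag_leffler_fps \<alpha> \<beta>"
  define f where "f = eval_fps F"
  have rad: "fps_conv_radius F = \<infinity>"
    unfolding F_def by (rule fps_conv_radius_mittag_leffler) fact
  obtain \<epsilon> where \<epsilon>: "\<epsilon> > 0" "\<And>z. z \<noteq> 0 \<Longrightarrow> \<bar>Arg z\<bar> < \<epsilon> \<Longrightarrow>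
      complex_of_real (cmod (f z)) = f (complex_of_real (Re z))"
    using assms(3) by (auto simp: mittag_leffler_eq_eval_fps f_def F_def)
  have "f holomorphic_on UNIV"
    unfolding f_def by (intro holomorphic_intros) (use rad in auto)
  moreover have "f (cnj z) = cnj (f z)" for z
  proof -
    have "(\<lambda>k. fps_nth F k * z ^ k) sums f z"
      unfolding f_def by (rule sums_eval_fps) (use rad in auto)
    then have "(\<lambda>k. cnj (fps_nth F k * z ^ k)) sums cnj (f z)"
      by (simp only: sums_cnj)
    then have "(\<lambda>k. fps_nth F k * cnj z ^ k) sums cnj (f z)"
      by (simp add: F_def)
    moreover have "(\<lambda>k. fps_nth F k * cnj z ^ k) sums f (cnj z)"
      unfolding f_def by (rule sums_eval_fps) (use rad in auto)
    ultimately show ?thesis by (rule sums_unique2[symmetric])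
  qed
  ultimately have mid: "f u * f v = (f ((u + v) / 2))\<^sup>2" for u v
    using \<epsilon> by (rule entire_mult_eq_midpoint_square)
  \<comment> \<open>The index 1 is chosen because \<alpha> + \<beta> > 0, whereas the constant
    coefficient vanishes if \<beta> = 0.\<close>
  have "fps_nth F 1 \<noteq> 0"
    using assms(1,2) by (auto simp: F_def rGamma_eq_zero_iff elim!: nonpos_Ints_cases')
  then have "F \<noteq> 0" by auto
  note * = fps_deriv_eq_const_mult[OF rad \<open>F \<noteq> 0\<close> mid[unfolded f_def]]
  \<comment> \<open>For \<beta> = 0 the constant coefficient would be \<open>rGamma 0\<close>, which
    is 0, contrary to f 0 being nonzero.\<close>
  have "\<beta> \<noteq> 0"
    using *(1) by (auto simp: F_def)
  then have "\<beta> > 0" using assms(2) by simp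
  obtain a where "fps_deriv F = fps_const a * F"
    using *(2) by blast
  then have "fps_nth (fps_deriv F) k = fps_nth (fps_const a * F) k" for k
    by simp
  then have rec: "of_nat (Suc k) * fps_nth F (Suc k) = a * fps_nth F k" for k
    by (simp del: of_nat_Suc)
  \<comment> \<open>The factor \<open>a\<close> is complex, but the coefficients are real, so taking
    real parts leaves a real recurrence with factor \<open>b\<close>.\<close>
  define b where "b = Re a"
  have recb: "real (Suc k) * rGamma (\<alpha> * real k + \<beta> + \<alpha>) = b * rGamma (\<alpha> * real k + \<beta>)" for k
  proof -
    have shift: "\<alpha> * real k + \<beta> + \<alpha> = \<alpha> * real (Suc k) + \<beta>"
      by (simp add: algebra_simps)
    show ?thesis
      using arg_cong[OF rec[of k], of Re]
      unfolding F_def b_def mittag_leffler_fps_nth shift by (simp del: of_nat_Suc)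
  qed
  show ?thesis
  proof (rule Gamma_recurrence_imp_one)
    fix k
    have "Gamma (\<alpha> * real k + \<beta>) > 0" "Gamma (\<alpha> * real k + \<beta> + \<alpha>) > 0"
      using assms(1) \<open>\<beta> > 0\<close> by (auto intro!: Gamma_real_pos add_nonneg_pos[OF mult_nonneg_nonneg] add_nonneg_pos[OF add_nonneg_nonneg])
    then show "real (Suc k) * Gamma (\<alpha> * real k + \<beta>) = b * Gamma (\<alpha> * real k + \<beta> + \<alpha>)"
      using recb[of k] by (simp add: rGamma_inverse_Gamma field_simps del: of_nat_Suc)
  qed fact+
qed

end
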